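(* Let $a_1(n),a_2(n),a_3(n),m(n)$ be integer-valued quasi-polynomials with positive leading coefficients. Then $p_{\{a_1(n),a_2(n),a_3(n)\}}(m(n))$, as a function of $n$, is an integer-valued quasi-polynomial (that is, it agrees for all sufficiently large $n$ with an integer-valued quasi-polynomial).
   Context: $\mathbb{N}=\{0,1,2,\dots\}$. An integer-valued quasi-polynomial is a function $f:\mathbb{N}\to\mathbb{Z}$ for which there exist positive integers $T,C$ and polynomials $f_i(x)\in\mathbb{Z}[x]$ ($0\le i\le T-1$) such that $f(n)=f_i(m)$ whenever $n>C$, $n=Tm+i$, $m\in\mathbb{N}$. We say $f$ has positive leading coefficients if all $f_i$ are nonzero with positive leading coefficient; then $f(n)>0$ for all sufficiently large $n$. For positive integers $b_1,b_2,b_3$ and an integer $t$, $p_{\{b_1,b_2,b_3\}}(t)=\#\{(x_1,x_2,x_3)\in\mathbb{Z}^3:\text{ all }x_j\ge0,\ x_1b_1+x_2b_2+x_3b_3=t\}$. *)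

theory Defs
  imports "HOL-Computational_Algebra.Polynomial"
begin

(* The polynomials are in the quotient m of n = T * m + i, not in n itself; only the
   constituents F i with i < T matter. *)
definition quasi_poly_rep ::
  "(nat \<Rightarrow> int) \<Rightarrow> nat \<Rightarrow> nat \<Rightarrow> (nat \<Rightarrow> int poly) \<Rightarrow> bool" where
  "quasi_poly_rep f T C F \<longleftrightarrow>
     T > 0 \<and> C > 0 \<and>
     (\<forall>n m i. n > C \<longrightarrow> i < T \<longrightarrow> n = T * m + i \<longrightarrow> f n = poly (F i) (int m))"

definition quasi_poly :: "(nat \<Rightarrow> int) \<Rightarrow> bool" where
  "quasi_poly f \<longleftrightarrow> (\<exists>T C F. quasi_poly_rep f T C F)"

(* Whether the condition holds does not depend on the representation (T, C, F) chosen. *)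
definition pos_quasi_poly :: "(nat \<Rightarrow> int) \<Rightarrow> bool" where
  "pos_quasi_poly f \<longleftrightarrow>
     (\<exists>T C F. quasi_poly_rep f T C F \<and> (\<forall>i<T. F i \<noteq> 0 \<and> lead_coeff (F i) > 0))"

(* Meaningful for b1, b2, b3 > 0, where the set is finite. The b's need not be distinct:
   they are coefficients indexed by position, not a set. *)
definition denumerant3 :: "int \<Rightarrow> int \<Rightarrow> int \<Rightarrow> int \<Rightarrow> nat" where
  "denumerant3 b1 b2 b3 t =
     card {(x1, x2, x3).
             x1 \<ge> 0 \<and> x2 \<ge> 0 \<and> x3 \<ge> 0 \<and> x1 * b1 + x2 * b2 + x3 * b3 = t}"

end

theory Submission imports Defs begin

text \<open>Quasi-polynomials are closed under the ring operations, case distinctions on the sign,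
  division with remainder and gcd, and they admit Bezout coefficients that are quasi-polynomials.
  With \<open>u a\<^sub>1 + v a\<^sub>2 = gcd a\<^sub>1 a\<^sub>2 = 1\<close>, the equation \<open>x\<^sub>1 a\<^sub>1 + x\<^sub>2 a\<^sub>2 = s\<close> has
  \<open>\<lfloor>v s / a\<^sub>1\<rfloor> + \<lfloor>u s / a\<^sub>2\<rfloor> + 1\<close> solutions in nonnegative integers for every \<open>s \<ge> 0\<close>; summing over the
  admissible residue class of \<open>x\<^sub>3\<close> turns the denumerant into floor sums
  \<open>\<Sum>k<K. \<lfloor>(A + B k) / C\<rfloor>\<close>. Such a sum is a quasi-polynomial whenever \<open>A, B, C, K\<close> are, by a
  Euclidean algorithm on \<open>(B, C)\<close> based on exchanging the two coordinates of the lattice points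
  that it counts.\<close>

section \<open>Residue classes, common periods and gluing\<close>

text \<open>As there are finitely many residue classes, a threshold for each class is as good as a
  global one. The class-wise form spares later proofs explicit bounds.\<close>

lemma quasi_poly_iff:
  "quasi_poly f \<longleftrightarrow>
     (\<exists>T>0. \<forall>i<T. \<exists>p. \<forall>\<^sub>F m in sequentially. f (T * m + i) = poly p (int m))"
proof
  assume "quasi_poly f"
  then obtain T C F where T: "T > 0"
    and F: "\<And>n m i. n > C \<Longrightarrow> i < T \<Longrightarrow> n = T * m + i \<Longrightarrow> f n = poly (F i) (int m)"
    unfolding quasi_poly_def quasi_poly_rep_def by blast
  have "\<forall>\<^sub>F m in sequentially. f (T * m + i) = poly (F i) (int m)" if "i < T" for i
    using eventually_gt_at_top[of C]
  proof eventually_elim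
    case (elim m)
    have "m \<le> T * m" using T by simp
    with elim have "C < T * m + i" by linarith
    then show ?case using F that by blast
  qed
  with T show "\<exists>T>0. \<forall>i<T. \<exists>p. \<forall>\<^sub>F m in sequentially. f (T * m + i) = poly p (int m)"
    by blast
next
  assume "\<exists>T>0. \<forall>i<T. \<exists>p. \<forall>\<^sub>F m in sequentially. f (T * m + i) = poly p (int m)"
  then obtain T F where T: "T > 0"
    and F: "\<forall>i\<in>{..<T}. \<forall>\<^sub>F m in sequentially. f (T * m + i) = poly (F i) (int m)"
    by (metis lessThan_iff)
  from F have "\<forall>\<^sub>F m in sequentially. \<forall>i\<in>{..<T}. f (T * m + i) = poly (F i) (int m)"
    by (intro eventually_ball_finite) auto
  then obtain N where N: "\<And>m i. m \<ge> N \<Longrightarrow> i < T \<Longrightarrow> f (T * m + i) = poly (F i) (int m)"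
    by (auto simp: eventually_sequentially)
  \<comment> \<open>The summand \<open>T\<close> in the threshold absorbs \<open>i < T\<close> and
    makes the threshold positive.\<close>
  have "f (T * m + i) = poly (F i) (int m)" if "T * m + i > T * N + T" "i < T" for m i
  proof (rule N)
    have "T * N < T * m" using that by linarith
    then show "N \<le> m" using T by simp
  qed (fact that)
  with T have "quasi_poly_rep f T (T * N + T) F"
    unfolding quasi_poly_rep_def by auto
  then show "quasi_poly f" unfolding quasi_poly_def by blast
qed

text \<open>Every multiple of a period is a period, for arbitrary offsets \<open>i\<close>: since
  \<open>T * S * m + i = T * (S * m + i div T) + i mod T\<close>, the constituent of
  \<open>i mod T\<close> is composed with a linear polynomial.\<close>

lemma quasi_poly_refine:
  assumes "quasi_poly f"
  obtains T where "T > 0"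
    "\<And>S i. S > 0 \<Longrightarrow> \<exists>p. \<forall>\<^sub>F m in sequentially. f (T * S * m + i) = poly p (int m)"
proof -
  from assms obtain T where T: "T > 0"
    and F: "\<And>i. i < T \<Longrightarrow> \<exists>p. \<forall>\<^sub>F m in sequentially. f (T * m + i) = poly p (int m)"
    unfolding quasi_poly_iff by blast
  have "\<exists>p. \<forall>\<^sub>F m in sequentially. f (T * S * m + i) = poly p (int m)" if S: "S > 0" for S i
  proof -
    from F[of "i mod T"] T obtain p
      where "\<forall>\<^sub>F m in sequentially. f (T * m + i mod T) = poly p (int m)" by auto
    then obtain N where N: "\<And>m. m \<ge> N \<Longrightarrow> f (T * m + i mod T) = poly p (int m)"
      by (auto simp: eventually_sequentially)
    have "f (T * S * m + i) = poly (pcompose p [:int (i div T), int S:]) (int m)"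
      if m: "m \<ge> N" for m
    proof -
      have "m \<le> S * m" using S by simp
      with m have "f (T * (S * m + i div T) + i mod T) = poly p (int (S * m + i div T))"
        by (intro N) linarith
      moreover have "T * (S * m + i div T) + i mod T = T * S * m + i"
        by (simp add: algebra_simps)
      ultimately show ?thesis by (simp add: poly_pcompose algebra_simps)
    qed
    then show ?thesis by (auto simp: eventually_sequentially)
  qed
  with T show ?thesis using that by blast
qed

text \<open>The product of the individual periods serves all members of the family.\<close>

lemma quasi_poly_common_period:
  assumes "finite J" and "\<And>j. j \<in> J \<Longrightarrow> quasi_poly (f j)"
  shows "\<exists>S>0. \<forall>j\<in>J. \<forall>i. \<exists>p. \<forall>\<^sub>F m in sequentially. f j (S * m + i) = poly p (int m)"
proof -
  define period where "period j T \<longleftrightarrow> T > 0 \<and>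
    (\<forall>S>0. \<forall>i. \<exists>p. \<forall>\<^sub>F m in sequentially. f j (T * S * m + i) = poly p (int m))" for j T
  have "\<exists>T. period j T" if "j \<in> J" for j
    by (rule quasi_poly_refine[OF assms(2)[OF that]]) (auto simp: period_def)
  then obtain T where period: "\<And>j. j \<in> J \<Longrightarrow> period j (T j)" by metis
  then have T: "\<And>j. j \<in> J \<Longrightarrow> T j > 0" unfolding period_def by blast
  have F: "\<exists>p. \<forall>\<^sub>F m in sequentially. f j (T j * S * m + i) = poly p (int m)"
    if "j \<in> J" "S > 0" for j S i
    using period[OF that(1)] that(2) unfolding period_def by blast
  have "\<exists>p. \<forall>\<^sub>F m in sequentially. f j (prod T J * m + i) = poly p (int m)" if "j \<in> J" for j i
  proof -
    have "prod T J = T j * prod T (J - {j})"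
      using assms(1) that by (rule prod.remove)
    moreover have "prod T (J - {j}) > 0"
      using T by (intro prod_pos) auto
    ultimately show ?thesis using F[OF that, of "prod T (J - {j})" i] by simp
  qed
  moreover have "prod T J > 0" using T by (intro prod_pos) auto
  ultimately show ?thesis by blast
qed

text \<open>The local witnesses are interleaved as \<open>U (n mod T) (n div T)\<close>. A relation
  \<open>R\<close> in place of an equation admits values that are not unique, such as Bezout
  coefficients.\<close>

lemma quasi_poly_glue:
  assumes T: "T > 0"
    and loc: "\<And>i. i < T \<Longrightarrow>
      \<exists>u. quasi_poly u \<and> (\<forall>\<^sub>F m in sequentially. R (T * m + i) (u m))"
  shows "\<exists>u. quasi_poly u \<and> (\<forall>\<^sub>F n in sequentially. R n (u n))"
proof -
  from loc obtain U where U: "\<And>i. i < T \<Longrightarrow> quasi_poly (U i)"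
    and R: "\<And>i. i < T \<Longrightarrow> \<forall>\<^sub>F m in sequentially. R (T * m + i) (U i m)"
    by metis
  define u where "u n = U (n mod T) (n div T)" for n
  obtain S where S: "S > 0" and SU: "\<And>j i. j < T \<Longrightarrow>
      \<exists>p. \<forall>\<^sub>F m in sequentially. U j (S * m + i) = poly p (int m)"
    using quasi_poly_common_period[of "{..<T}" U] U by auto
  have "\<exists>p. \<forall>\<^sub>F m in sequentially. u (T * S * m + i) = poly p (int m)" for i
  proof -
    have "u (T * S * m + i) = U (i mod T) (S * m + i div T)" for m
      using T by (simp add: u_def mult.assoc)
    then show ?thesis using SU[of "i mod T" "i div T"] T by simp
  qed
  then have "quasi_poly u"
    unfolding quasi_poly_iff using T S by (intro exI[of _ "T * S"]) auto
  moreover have "\<forall>\<^sub>F n in sequentially. R n (u n)"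
  proof -
    have "\<forall>\<^sub>F m in sequentially. \<forall>i\<in>{..<T}. R (T * m + i) (U i m)"
      using R by (intro eventually_ball_finite) auto
    then obtain N where N: "\<And>m i. m \<ge> N \<Longrightarrow> i < T \<Longrightarrow> R (T * m + i) (U i m)"
      by (auto simp: eventually_sequentially)
    have "R n (u n)" if "n \<ge> T * N" for n
    proof -
      have "N \<le> n div T" using T that by (simp add: less_eq_div_iff_mult_less_eq mult.commute)
      from N[OF this, of "n mod T"] T show ?thesis by (simp add: u_def)
    qed
    then show ?thesis by (auto simp: eventually_sequentially)
  qed
  ultimately show ?thesis by blast
qed

lemma eventually_progression:
  assumes "\<forall>\<^sub>F n in sequentially. P n" and "T > 0"
  shows "\<forall>\<^sub>F m in sequentially. P (T * m + i)"
proof -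
  from assms(1) obtain N where "\<And>n. n \<ge> N \<Longrightarrow> P n" by (auto simp: eventually_sequentially)
  moreover have "m \<le> T * m" for m using assms(2) by simp
  ultimately show ?thesis
    unfolding eventually_sequentially by (meson le_add1 le_trans)
qed

lemma quasi_poly_cong:
  assumes "\<forall>\<^sub>F n in sequentially. f n = g n" and "quasi_poly f"
  shows "quasi_poly g"
proof -
  from assms(2) obtain T where T: "T > 0"
    and F: "\<And>i. i < T \<Longrightarrow> \<exists>p. \<forall>\<^sub>F m in sequentially. f (T * m + i) = poly p (int m)"
    unfolding quasi_poly_iff by blast
  have "\<exists>p. \<forall>\<^sub>F m in sequentially. g (T * m + i) = poly p (int m)" if "i < T" for i
  proof -
    from F[OF that] obtain p where p: "\<forall>\<^sub>F m in sequentially. f (T * m + i) = poly p (int m)"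
      by blast
    from eventually_progression[OF assms(1) T, of i] p
    have "\<forall>\<^sub>F m in sequentially. g (T * m + i) = poly p (int m)"
      by eventually_elim simp
    then show ?thesis by blast
  qed
  with T show ?thesis unfolding quasi_poly_iff by blast
qed

lemma quasi_poly_progression:
  assumes "quasi_poly f" and "T > 0"
  shows "quasi_poly (\<lambda>m. f (T * m + i))"
proof -
  obtain S where S: "S > 0"
    and F: "\<And>T i. T > 0 \<Longrightarrow> \<exists>p. \<forall>\<^sub>F m in sequentially. f (S * T * m + i) = poly p (int m)"
    using assms(1) by (rule quasi_poly_refine) blast
  have "\<exists>p. \<forall>\<^sub>F m in sequentially. f (T * (S * m + j) + i) = poly p (int m)" for j
    using F[OF assms(2), of "T * j + i"] by (simp add: algebra_simps)
  with S show ?thesis unfolding quasi_poly_iff by blast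
qed

lemma quasi_poly_local:
  assumes "quasi_poly b" and "quasi_poly c"
    and "\<And>T i p q. T > 0 \<Longrightarrow> \<forall>\<^sub>F m in sequentially. b (T * m + i) = poly p (int m) \<Longrightarrow>
      \<forall>\<^sub>F m in sequentially. c (T * m + i) = poly q (int m) \<Longrightarrow>
      \<exists>u. quasi_poly u \<and> (\<forall>\<^sub>F m in sequentially. R (T * m + i) (u m))"
  shows "\<exists>u. quasi_poly u \<and> (\<forall>\<^sub>F n in sequentially. R n (u n))"
proof -
  \<comment> \<open>Indexing the two functions by \<open>bool\<close> lets the lemma on finite
    families give one period for both.\<close>
  obtain S where S: "S > 0" and p: "\<forall>j::bool. \<forall>i. \<exists>p. \<forall>\<^sub>F m in sequentially.
      (if j then b else c) (S * m + i) = poly p (int m)"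
  proof -
    have "quasi_poly (if j then b else c)" for j using assms(1,2) by simp
    then have "\<exists>S>0. \<forall>j\<in>UNIV. \<forall>i. \<exists>p. \<forall>\<^sub>F m in sequentially.
        (if j then b else c) (S * m + i) = poly p (int m)"
      by (intro quasi_poly_common_period) simp_all
    with that show ?thesis by blast
  qed
  show ?thesis
  proof (rule quasi_poly_glue[OF S])
    fix i
    obtain p q where "\<forall>\<^sub>F m in sequentially. b (S * m + i) = poly p (int m)"
      "\<forall>\<^sub>F m in sequentially. c (S * m + i) = poly q (int m)"
      using p[rule_format, of True i] p[rule_format, of False i] by auto
    from assms(3)[OF S this]
    show "\<exists>u. quasi_poly u \<and> (\<forall>\<^sub>F m in sequentially. R (S * m + i) (u m))" .
  qed
qed

text \<open>The case where \<open>R\<close> forces the witness to be \<open>f\<close> itself. It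
  reduces closure properties to arguments \<open>b\<close>, \<open>c\<close> that are polynomials
  along a progression.\<close>

lemma quasi_poly_localI:
  assumes "quasi_poly b" and "quasi_poly c"
    and "\<And>T i p q. T > 0 \<Longrightarrow> \<forall>\<^sub>F m in sequentially. b (T * m + i) = poly p (int m) \<Longrightarrow>
      \<forall>\<^sub>F m in sequentially. c (T * m + i) = poly q (int m) \<Longrightarrow>
      quasi_poly (\<lambda>m. f (T * m + i))"
  shows "quasi_poly f"
proof -
  have "\<exists>u. quasi_poly u \<and> (\<forall>\<^sub>F n in sequentially. u n = f n)"
  proof (rule quasi_poly_local[OF assms(1,2), where R = "\<lambda>n x. x = f n"])
    fix T i p q
    assume "T > 0" "\<forall>\<^sub>F m in sequentially. b (T * m + i) = poly p (int m)"
      "\<forall>\<^sub>F m in sequentially. c (T * m + i) = poly q (int m)"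
    from assms(3)[OF this]
    show "\<exists>u. quasi_poly u \<and> (\<forall>\<^sub>F m in sequentially. u m = f (T * m + i))"
      by (intro exI[of _ "\<lambda>m. f (T * m + i)"]) simp
  qed
  then obtain u where "quasi_poly u" "\<forall>\<^sub>F n in sequentially. u n = f n" by blast
  then show ?thesis by (intro quasi_poly_cong[of u f])
qed

section \<open>Ring operations\<close>

lemma quasi_poly_poly: "quasi_poly (\<lambda>n. poly p (int n))"
  unfolding quasi_poly_iff by (intro exI[of _ 1]) (auto intro!: exI[of _ p])

lemma quasi_poly_const [simp]: "quasi_poly (\<lambda>_. c)"
  using quasi_poly_poly[of "[:c:]"] by simp

lemma quasi_poly_add:
  assumes "quasi_poly f" and "quasi_poly g"
  shows "quasi_poly (\<lambda>n. f n + g n)"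
proof (rule quasi_poly_localI[OF assms])
  fix T i p q
  assume "\<forall>\<^sub>F m in sequentially. f (T * m + i) = poly p (int m)"
    "\<forall>\<^sub>F m in sequentially. g (T * m + i) = poly q (int m)"
  then have "\<forall>\<^sub>F m in sequentially. poly (p + q) (int m) = f (T * m + i) + g (T * m + i)"
    by eventually_elim simp
  then show "quasi_poly (\<lambda>m. f (T * m + i) + g (T * m + i))"
    by (rule quasi_poly_cong) (rule quasi_poly_poly)
qed

lemma quasi_poly_mult:
  assumes "quasi_poly f" and "quasi_poly g"
  shows "quasi_poly (\<lambda>n. f n * g n)"
proof (rule quasi_poly_localI[OF assms])
  fix T i p q
  assume "\<forall>\<^sub>F m in sequentially. f (T * m + i) = poly p (int m)"
    "\<forall>\<^sub>F m in sequentially. g (T * m + i) = poly q (int m)"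
  then have "\<forall>\<^sub>F m in sequentially. poly (p * q) (int m) = f (T * m + i) * g (T * m + i)"
    by eventually_elim simp
  then show "quasi_poly (\<lambda>m. f (T * m + i) * g (T * m + i))"
    by (rule quasi_poly_cong) (rule quasi_poly_poly)
qed

lemma quasi_poly_uminus: "quasi_poly f \<Longrightarrow> quasi_poly (\<lambda>n. - f n)"
  using quasi_poly_mult[OF quasi_poly_const[of "-1"], of f] by simp

lemma quasi_poly_diff: "quasi_poly f \<Longrightarrow> quasi_poly g \<Longrightarrow> quasi_poly (\<lambda>n. f n - g n)"
  using quasi_poly_add[of f "\<lambda>n. - g n"] quasi_poly_uminus[of g] by simp

lemma quasi_poly_sum:
  assumes "\<And>j. j \<in> J \<Longrightarrow> quasi_poly (f j)"
  shows "quasi_poly (\<lambda>n. \<Sum>j\<in>J. f j n)"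
  using assms by (induction J rule: infinite_finite_induct) (simp_all add: quasi_poly_add)

section \<open>Eventual signs and case distinctions\<close>

text \<open>Horner's scheme: a positive value of the tail is at least 1 by integrality, so
  \<open>n\<close> times the tail outweighs the constant coefficient once
  \<open>n > \<bar>a\<bar>\<close>.\<close>

lemma eventually_poly_pos:
  assumes "lead_coeff p > 0"
  shows "\<forall>\<^sub>F n in sequentially. poly p (int n) > 0"
  using assms
proof (induction p)
  case (pCons a p)
  show ?case
  proof (cases "p = 0")
    case False
    with pCons have "\<forall>\<^sub>F n in sequentially. poly p (int n) > 0" by simp
    then show ?thesis using eventually_gt_at_top[of "nat \<bar>a\<bar>"]
    proof eventually_elim
      case (elim n)
      then have "int n * 1 \<le> int n * poly p (int n)" by (intro mult_left_mono) auto
      moreover have "\<bar>a\<bar> < int n" using elim by linarith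
      ultimately have "a + int n * poly p (int n) > 0" by linarith
      then show ?case by simp
    qed
  qed (use pCons in simp)
qed simp

lemma poly_sign_cases:
  fixes p :: "int poly"
  obtains "p = 0" | "\<forall>\<^sub>F n in sequentially. poly p (int n) > 0"
    | "\<forall>\<^sub>F n in sequentially. poly p (int n) < 0"
proof -
  consider "p = 0" | "lead_coeff p > 0" | "lead_coeff (- p) > 0"
    by (metis lead_coeff_minus leading_coeff_0_iff linorder_neqE_linordered_idom neg_0_less_iff_less)
  then show ?thesis
    using that eventually_poly_pos[of p] eventually_poly_pos[of "- p"] by cases auto
qed

lemma quasi_poly_if_nonneg:
  assumes "quasi_poly f" and "quasi_poly g" and "quasi_poly h"
  shows "quasi_poly (\<lambda>n. if f n \<ge> 0 then g n else h n)"
proof (rule quasi_poly_localI[OF assms(1,1)])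
  fix T i p
  assume T: "T > 0" and p: "\<forall>\<^sub>F m in sequentially. f (T * m + i) = poly p (int m)"
  consider "\<forall>\<^sub>F m in sequentially. poly p (int m) \<ge> 0" | "\<forall>\<^sub>F m in sequentially. poly p (int m) < 0"
  proof (cases p rule: poly_sign_cases)
    case 2
    then have "\<forall>\<^sub>F m in sequentially. poly p (int m) \<ge> 0" by eventually_elim simp
    then show ?thesis by (rule that(1))
  qed (use that in simp_all)
  then show "quasi_poly (\<lambda>m. if f (T * m + i) \<ge> 0 then g (T * m + i) else h (T * m + i))"
  proof cases
    case 1
    with p have "\<forall>\<^sub>F m in sequentially. g (T * m + i) =
        (if f (T * m + i) \<ge> 0 then g (T * m + i) else h (T * m + i))"
      by eventually_elim simp
    then show ?thesis
      by (rule quasi_poly_cong) (rule quasi_poly_progression[OF assms(2) T])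
  next
    case 2
    with p have "\<forall>\<^sub>F m in sequentially. h (T * m + i) =
        (if f (T * m + i) \<ge> 0 then g (T * m + i) else h (T * m + i))"
      by eventually_elim simp
    then show ?thesis
      by (rule quasi_poly_cong) (rule quasi_poly_progression[OF assms(3) T])
  qed
qed

lemma quasi_poly_if_zero:
  assumes "quasi_poly f" and "quasi_poly g" and "quasi_poly h"
  shows "quasi_poly (\<lambda>n. if f n = 0 then g n else h n)"
proof -
  \<comment> \<open>The zero test is a pair of sign tests, on \<open>f\<close> and on
    \<open>- f\<close>.\<close>
  have "quasi_poly (\<lambda>n. if f n \<ge> 0 then if - f n \<ge> 0 then g n else h n else h n)"
    using assms by (intro quasi_poly_if_nonneg quasi_poly_uminus)
  then show ?thesis
    by (rule quasi_poly_cong[rotated]) auto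
qed

subsection \<open>Division and Bezout coefficients\<close>

text \<open>Beyond the congruence modulo \<open>d\<close>, the quotient of the difference is an
  integer polynomial in \<open>x\<close>. This keeps the coefficients integral when dividing by a
  constant.\<close>

lemma poly_progression_cong:
  fixes p :: "int poly"
  shows "\<exists>s. \<forall>x. poly p (d * x + j) = poly p j + d * poly s x"
proof (induction p)
  case 0
  then show ?case by (auto intro: exI[of _ 0])
next
  case (pCons a p)
  then obtain s where "\<And>x. poly p (d * x + j) = poly p j + d * poly s x" by blast
  then show ?case
    by (intro exI[of _ "[:0, poly p j:] + [:j, d:] * s"]) (simp add: algebra_simps)
qed

lemma quasi_poly_div_const:
  assumes "quasi_poly f"
  shows "quasi_poly (\<lambda>n. f n div int d)"
proof (cases "d = 0")
  case False
  have poly: "quasi_poly (\<lambda>n. poly p (int n) div int d)" for p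
  proof -
    have "\<exists>q. \<forall>\<^sub>F m in sequentially. poly p (int (d * m + i)) div int d = poly q (int m)" for i
    proof -
      obtain s where s: "\<And>x. poly p (int d * x + int i) = poly p (int i) + int d * poly s x"
        using poly_progression_cong by blast
      have "poly p (int (d * m + i)) div int d = poly ([:poly p (int i) div int d:] + s) (int m)" for m
        using False s[of "int m"] by simp
      then show ?thesis by (intro exI always_eventually allI)
    qed
    with False show ?thesis unfolding quasi_poly_iff by blast
  qed
  show ?thesis
  proof (rule quasi_poly_localI[OF assms assms])
    fix T i p
    assume "\<forall>\<^sub>F m in sequentially. f (T * m + i) = poly p (int m)"
    then have "\<forall>\<^sub>F m in sequentially. poly p (int m) div int d = f (T * m + i) div int d"
      by eventually_elim simp
    then show "quasi_poly (\<lambda>m. f (T * m + i) div int d)"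
      by (rule quasi_poly_cong) (rule poly)
  qed
qed simp

lemma quasi_poly_mod_const:
  assumes "quasi_poly f"
  shows "quasi_poly (\<lambda>n. f n mod int d)"
  unfolding minus_mult_div_eq_mod [symmetric]
  using assms by (intro quasi_poly_diff quasi_poly_mult quasi_poly_div_const) auto

text \<open>Pseudo-division scales \<open>p\<close> by a power \<open>c\<close> of the leading
  coefficient, which may be negative; scaling by \<open>c\<close> once more makes the factor
  positive.\<close>

lemma int_poly_pseudo_division:
  fixes p q :: "int poly"
  assumes "q \<noteq> 0"
  obtains d :: nat and h r
  where "d > 0" "smult (int d) p = h * q + r" "r = 0 \<or> degree r < degree q"
proof -
  obtain h r where hr: "pseudo_divmod p q = (h, r)" by fastforce
  define c where "c = lead_coeff q ^ (Suc (degree p) - degree q)"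
  from pseudo_divmod[OF assms hr]
  have eq: "smult c p = q * h + r" and r: "r = 0 \<or> degree r < degree q"
    by (auto simp: c_def)
  have "c \<noteq> 0" using assms by (simp add: c_def)
  have "smult (c * c) p = smult c h * q + smult c r"
    using arg_cong[OF eq, of "smult c"] by (simp add: smult_add_right mult.commute)
  moreover have "int (nat (c * c)) = c * c" by simp
  moreover have "nat (c * c) > 0"
    using \<open>c \<noteq> 0\<close> by (simp add: zero_less_mult_iff linorder_neq_iff disj_commute)
  moreover have "smult c r = 0 \<or> degree (smult c r) < degree q" using r by auto
  ultimately show ?thesis
    using that[of "nat (c * c)" "smult c h" "smult c r"] by simp
qed

lemma eventually_abs_poly_less:
  fixes q r :: "int poly"
  assumes q: "\<forall>\<^sub>F n in sequentially. poly q (int n) > 0"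
    and r: "r = 0 \<or> degree r < degree q"
  shows "\<forall>\<^sub>F n in sequentially. \<bar>poly r (int n)\<bar> < poly q (int n)"
proof (cases "r = 0")
  case False
  with r have deg: "degree r < degree q" by simp
  have lq: "lead_coeff q > 0"
  proof (rule ccontr)
    assume "\<not> lead_coeff q > 0"
    with deg have "lead_coeff (- q) > 0" 
      by (metis degree_0 lead_coeff_minus leading_coeff_0_iff less_nat_zero_code linorder_neqE_linordered_idom neg_0_less_iff_less)
    from eventually_poly_pos[OF this] q have "\<forall>\<^sub>F n::nat in sequentially. False"
      by eventually_elim simp
    then show False by simp
  qed
  \<comment> \<open>Adding or subtracting \<open>r\<close> leaves the leading term of
    \<open>q\<close> alone, so both polynomials are eventually positive.\<close>
  have "lead_coeff (q + r) > 0" "lead_coeff (q - r) > 0"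
    using lq deg degree_add_eq_left[of "- r" q] by (auto simp: degree_add_eq_left coeff_eq_0)
  from this[THEN eventually_poly_pos] show ?thesis
    by eventually_elim auto
qed (use q in simp)

text \<open>With \<open>h = d * w + c\<close>, the number \<open>d * (f - w * g)\<close> equals
  \<open>c * g + r\<close>, and \<open>f - w * g\<close> lies strictly between \<open>- g\<close>
  and \<open>g\<close>. So the floor is \<open>w\<close> or \<open>w - 1\<close>, decided by the
  sign of \<open>c * g + r\<close>.\<close>

lemma div_via_pseudo_division:
  fixes f g h r d :: int
  assumes "d > 0" "\<bar>r\<bar> < g" "d * f = h * g + r"
  shows "f div g = h div d + (if (h mod d) * g + r \<ge> 0 then 0 else - 1)"
proof -
  define w c where "w = h div d" and "c = h mod d"
  have h: "h = d * w + c" and c: "0 \<le> c" "c < d" using assms(1) by (auto simp: w_def c_def)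
  have e: "d * (f - w * g) = c * g + r" using assms(3) h by (simp add: algebra_simps)
  have "c * g \<le> (d - 1) * g" using c assms(2) by (intro mult_right_mono) auto
  then have "d * (f - w * g) < d * g" using e assms(2) by (simp add: algebra_simps)
  then have u: "f - w * g < g" using assms(1) by simp
  have "0 \<le> c * g" using c assms(2) by simp
  then have "c * g + r > - g" using assms(2) by linarith
  moreover have "- (d * g) \<le> - g" using mult_right_mono[of 1 d g] assms(1,2) by simp
  ultimately have "d * (- g) < d * (f - w * g)" using e by simp
  then have l: "- g < f - w * g" using assms(1) by (simp only: mult_less_cancel_left_pos)
  have "c * g + r \<ge> 0 \<longleftrightarrow> f - w * g \<ge> 0" using e assms(1) by (metis zero_le_mult_iff not_less order.asym)
  moreover have "f div g = w" if "f - w * g \<ge> 0"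
    using that u by (intro int_div_pos_eq[of _ _ _ "f - w * g"]) auto
  moreover have "f div g = w - 1" if "f - w * g < 0"
    using that l by (intro int_div_pos_eq[of _ _ _ "f - w * g + g"]) (auto simp: algebra_simps)
  ultimately show ?thesis
    unfolding w_def[symmetric] c_def[symmetric] by auto
qed

lemma quasi_poly_div:
  assumes "quasi_poly f" and "quasi_poly g"
  shows "quasi_poly (\<lambda>n. f n div g n)"
proof -
  have pos: "quasi_poly (\<lambda>n. poly p (int n) div poly q (int n))"
    if q: "\<forall>\<^sub>F n in sequentially. poly q (int n) > 0" for p q
  proof -
    have "q \<noteq> 0" using q by auto
    then obtain d h r where d: "d > 0" and eq: "smult (int d) p = h * q + r"
      and r: "r = 0 \<or> degree r < degree q"
      by (rule int_poly_pseudo_division)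
    have e: "int d * poly p x = poly h x * poly q x + poly r x" for x
      using arg_cong[OF eq, of "\<lambda>p. poly p x"] by simp
    have "\<forall>\<^sub>F n in sequentially. poly h (int n) div int d +
        (if poly h (int n) mod int d * poly q (int n) + poly r (int n) \<ge> 0 then 0 else - 1)
        = poly p (int n) div poly q (int n)"
      using eventually_abs_poly_less[OF q r]
      by eventually_elim (rule div_via_pseudo_division[symmetric, OF _ _ e], use d in auto)
    then show ?thesis
      by (rule quasi_poly_cong)
        (intro quasi_poly_add quasi_poly_div_const quasi_poly_if_nonneg quasi_poly_mult
          quasi_poly_mod_const quasi_poly_poly quasi_poly_const)
  qed
  show ?thesis
  proof (rule quasi_poly_localI[OF assms])
    fix T i p q
    assume "\<forall>\<^sub>F m in sequentially. f (T * m + i) = poly p (int m)"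
      "\<forall>\<^sub>F m in sequentially. g (T * m + i) = poly q (int m)"
    then have ev: "\<forall>\<^sub>F m in sequentially.
        poly p (int m) div poly q (int m) = f (T * m + i) div g (T * m + i)"
      by eventually_elim simp
    \<comment> \<open>A zero divisor gives the quotient 0 by convention; an eventually negative one
      is treated by negating both polynomials.\<close>
    have "quasi_poly (\<lambda>n. poly p (int n) div poly q (int n))"
    proof (cases q rule: poly_sign_cases)
      case 3
      then have "quasi_poly (\<lambda>n. poly (- p) (int n) div poly (- q) (int n))"
        by (intro pos) simp
      then show ?thesis by simp
    qed (simp_all add: pos)
    with ev show "quasi_poly (\<lambda>m. f (T * m + i) div g (T * m + i))"
      by (rule quasi_poly_cong)
  qed
qed

lemma quasi_poly_mod:
  assumes "quasi_poly f" and "quasi_poly g"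
  shows "quasi_poly (\<lambda>n. f n mod g n)"
  unfolding minus_mult_div_eq_mod [symmetric]
  using assms by (intro quasi_poly_diff quasi_poly_mult quasi_poly_div)

text \<open>There are only finitely many residues, so an arbitrary \<open>S\<close> becomes a finite
  sum of zero tests.\<close>

lemma quasi_poly_residue_fun:
  fixes S :: "int \<Rightarrow> int"
  assumes "quasi_poly f" and "d > 0"
  shows "quasi_poly (\<lambda>n. S (f n mod int d))"
proof -
  have "quasi_poly (\<lambda>n. \<Sum>c\<in>{0..<int d}. if f n mod int d - c = 0 then S c else 0)"
    using assms by (intro quasi_poly_sum quasi_poly_if_zero quasi_poly_diff quasi_poly_mod_const) auto
  moreover have "(\<Sum>c\<in>{0..<int d}. if x mod int d - c = 0 then S c else 0) = S (x mod int d)" for x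
    using assms(2) by (simp add: sum.delta)
  ultimately show ?thesis by simp
qed

text \<open>Removes the factor \<open>d\<close> in the Bezout induction: \<open>e * gcd k d\<close>
  is the gcd of \<open>d * f\<close> and \<open>d * e\<close>, and \<open>d * e\<close> is itself
  the gcd of \<open>d * (d * f)\<close> and \<open>d * g\<close>; the first of these is a multiple
  of \<open>d * f\<close>.\<close>

lemma gcd_mult_right_via_gcd:
  fixes d f g e k :: int
  assumes "e = gcd (d * f) g" and "d * f = e * k" and "d > 0"
  shows "e * gcd k d = d * gcd f g"
proof -
  have "e \<ge> 0" using assms(1) by simp
  then have "e * gcd k d = gcd (e * k) (e * d)"
    by (simp add: gcd_mult_left)
  also have "\<dots> = gcd (d * f) (d * e)"
    using assms(2) by (simp add: mult.commute)
  also have "d * e = gcd (d * (d * f)) (d * g)"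
    using assms(1,3) by (simp add: gcd_mult_left)
  also have "gcd (d * f) (gcd (d * (d * f)) (d * g)) = gcd (d * f) (d * g)"
    by (simp add: gcd.assoc[symmetric] gcd_proj1_if_dvd)
  also have "\<dots> = d * gcd f g" using assms(3) by (simp add: gcd_mult_left)
  finally show ?thesis .
qed

text \<open>Induction on \<open>degree q\<close> with \<open>d * p = h * q + r\<close>: a Bezout identity for \<open>(q, r)\<close> is one for
  \<open>(d * p, q)\<close>, and the surplus factor \<open>d\<close> is removed with the gcd of \<open>d\<close> and
  \<open>k = d * p div gcd (d * p) q\<close>, which depends on \<open>k mod d\<close> only.\<close>

lemma poly_bezout_quasi_poly:
  fixes p q :: "int poly"
  shows "\<exists>u v. quasi_poly u \<and> quasi_poly v \<and>
    (\<forall>n. u n * poly p (int n) + v n * poly q (int n) = gcd (poly p (int n)) (poly q (int n)))"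
proof (induction "if q = 0 then 0 else Suc (degree q)" arbitrary: p q rule: less_induct)
  case less
  show ?case
  proof (cases "q = 0")
    case True
    \<comment> \<open>The gcd is nonnegative, so the coefficient has to be the sign of
      \<open>p\<close>.\<close>
    have "quasi_poly (\<lambda>n. if poly p (int n) \<ge> 0 then 1 else - 1)"
      by (intro quasi_poly_if_nonneg quasi_poly_poly quasi_poly_const)
    then show ?thesis
      using True by (intro exI[of _ "\<lambda>n. if poly p (int n) \<ge> 0 then 1 else - 1"]
          exI[of _ "\<lambda>_. 0"]) auto
  next
    case False
    then obtain d h r where d: "d > 0" and eq: "smult (int d) p = h * q + r"
      and r: "r = 0 \<or> degree r < degree q"
      by (rule int_poly_pseudo_division)
    define P Q H R where "P n = poly p (int n)" and "Q n = poly q (int n)"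
      and "H n = poly h (int n)" and "R n = poly r (int n)" for n
    have qp: "quasi_poly P" "quasi_poly Q" "quasi_poly H" "quasi_poly R"
      unfolding P_def Q_def H_def R_def by (rule quasi_poly_poly)+
    have eq: "int d * P n = H n * Q n + R n" for n
      using arg_cong[OF eq, of "\<lambda>p. poly p (int n)"] by (simp add: P_def Q_def H_def R_def)
    obtain u v where uv: "quasi_poly u" "quasi_poly v"
      and bez: "\<And>n. u n * Q n + v n * R n = gcd (Q n) (R n)"
    proof -
      have "(if r = 0 then 0 else Suc (degree r)) < (if q = 0 then 0 else Suc (degree q))"
        using r False by auto
      from less[OF this, of q] show ?thesis using that unfolding Q_def R_def by blast
    qed
    define E where "E n = gcd (int d * P n) (Q n)" for n
    define k where "k n = int d * P n div E n" for n
    \<comment> \<open>An unstructured choice of coefficients is harmless here, because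
      \<open>S\<close> is evaluated at residues modulo \<open>d\<close> only.\<close>
    define S where "S c = fst (bezout_coefficients c (int d))" for c
    define s where "s n = S (k n mod int d)" for n
    define t where "t n = (gcd (k n mod int d) (int d) - s n * k n) div int d" for n
    have E: "E n = v n * (int d * P n) + (u n - v n * H n) * Q n" for n
    proof -
      have "E n = gcd (Q n) (R n)" unfolding E_def eq by (simp add: gcd.commute gcd_add_mult)
      also have "\<dots> = v n * (int d * P n) + (u n - v n * H n) * Q n"
        unfolding eq bez[symmetric] by (simp add: algebra_simps)
      finally show ?thesis .
    qed
    have "quasi_poly E" unfolding E
      by (intro quasi_poly_add quasi_poly_mult quasi_poly_diff quasi_poly_const uv qp)
    then have "quasi_poly k"
      unfolding k_def by (intro quasi_poly_div quasi_poly_mult quasi_poly_const qp)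
    then have s: "quasi_poly s" and "quasi_poly (\<lambda>n. gcd (k n mod int d) (int d))"
      unfolding s_def using quasi_poly_residue_fun[of k d "\<lambda>c. gcd c (int d)"]
      by (auto intro: quasi_poly_residue_fun d)
    with \<open>quasi_poly k\<close> have t: "quasi_poly t"
      unfolding t_def by (intro quasi_poly_div quasi_poly_mult quasi_poly_diff quasi_poly_const)
    have "(s n + t n * v n * int d) * P n + t n * (u n - v n * H n) * Q n = gcd (P n) (Q n)" for n
    proof -
      have "s n * (k n mod int d) + snd (bezout_coefficients (k n mod int d) (int d)) * int d
          = gcd (k n mod int d) (int d)"
        unfolding s_def S_def by (rule bezout_coefficients_fst_snd)
      \<comment> \<open>Replacing \<open>k n mod int d\<close> by \<open>k n\<close> changes the
        identity by a multiple of \<open>d\<close>, so the division defining \<open>t\<close> is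
        exact.\<close>
      moreover have "G - x * y = D * (z - x * w)"
        if "x * c + z * D = G" "D * w + c = y" for G D c w x y z :: int
        using that by (auto simp: algebra_simps)
      ultimately have "gcd (k n mod int d) (int d) - s n * k n =
          int d * (snd (bezout_coefficients (k n mod int d) (int d)) - s n * (k n div int d))"
        using mult_div_mod_eq by blast
      then have "int d dvd gcd (k n mod int d) (int d) - s n * k n" by simp
      then have st: "s n * k n + t n * int d = gcd (k n) (int d)"
        using d by (simp add: t_def gcd.commute[of _ "int d"] gcd_red_int[symmetric])
      have Ek: "int d * P n = E n * k n"
        by (simp add: k_def E_def)
      \<comment> \<open>After scaling by \<open>d\<close>, the Bezout identity for \<open>E\<close>
        collapses the sum to \<open>E n * gcd (k n) (int d)\<close>.\<close>
      have "int d * ((s n + t n * v n * int d) * P n + t n * (u n - v n * H n) * Q n)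
          = s n * (int d * P n) + t n * int d * E n"
        by (simp add: E algebra_simps)
      also have "\<dots> = E n * (s n * k n + t n * int d)"
        by (simp add: Ek algebra_simps)
      also have "\<dots> = int d * gcd (P n) (Q n)"
        unfolding st using E_def Ek d by (intro gcd_mult_right_via_gcd) auto
      finally show ?thesis using d by simp
    qed
    moreover have "quasi_poly (\<lambda>n. s n + t n * v n * int d)"
      "quasi_poly (\<lambda>n. t n * (u n - v n * H n))"
      by (intro quasi_poly_add quasi_poly_mult quasi_poly_diff quasi_poly_const uv qp s t)+
    ultimately show ?thesis unfolding P_def Q_def by blast
  qed
qed

lemma quasi_poly_gcd:
  assumes "quasi_poly f" and "quasi_poly g"
  shows "quasi_poly (\<lambda>n. gcd (f n) (g n))"
proof (rule quasi_poly_localI[OF assms])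
  fix T i p q
  assume ev: "\<forall>\<^sub>F m in sequentially. f (T * m + i) = poly p (int m)"
    "\<forall>\<^sub>F m in sequentially. g (T * m + i) = poly q (int m)"
  obtain u v where uv: "quasi_poly u" "quasi_poly v"
    and bez: "\<And>n. u n * poly p (int n) + v n * poly q (int n) = gcd (poly p (int n)) (poly q (int n))"
    using poly_bezout_quasi_poly by blast
  have "\<forall>\<^sub>F m in sequentially.
      u m * poly p (int m) + v m * poly q (int m) = gcd (f (T * m + i)) (g (T * m + i))"
    using ev unfolding bez by eventually_elim simp
  then show "quasi_poly (\<lambda>m. gcd (f (T * m + i)) (g (T * m + i)))"
    by (rule quasi_poly_cong) (intro quasi_poly_add quasi_poly_mult quasi_poly_poly uv)
qed

lemma quasi_poly_bezout:
  assumes "quasi_poly f" and "quasi_poly g"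
  obtains u v where "quasi_poly u" "quasi_poly v"
    "\<forall>\<^sub>F n in sequentially. u n * f n + v n * g n = gcd (f n) (g n)"
proof -
  \<comment> \<open>Only \<open>u\<close> is glued from local data; the second coefficient is then
    recovered by exact division by \<open>g n\<close>.\<close>
  have "\<exists>u. quasi_poly u \<and> (\<forall>\<^sub>F n in sequentially. g n dvd gcd (f n) (g n) - u n * f n)"
  proof (rule quasi_poly_local[OF assms, where R = "\<lambda>n x. g n dvd gcd (f n) (g n) - x * f n"])
    fix T i p q
    assume ev: "\<forall>\<^sub>F m in sequentially. f (T * m + i) = poly p (int m)"
      "\<forall>\<^sub>F m in sequentially. g (T * m + i) = poly q (int m)"
    obtain u v where uv: "quasi_poly u" "quasi_poly v"
      and bez: "\<And>n. u n * poly p (int n) + v n * poly q (int n)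
        = gcd (poly p (int n)) (poly q (int n))"
      using poly_bezout_quasi_poly by blast
    have "\<forall>\<^sub>F m in sequentially. g (T * m + i) dvd
        gcd (f (T * m + i)) (g (T * m + i)) - u m * f (T * m + i)"
      using ev
    proof eventually_elim
      case (elim m)
      have "gcd (poly p (int m)) (poly q (int m)) - u m * poly p (int m) = v m * poly q (int m)"
        using bez[of m] by simp
      then show ?case unfolding elim by simp
    qed
    with uv show "\<exists>u. quasi_poly u \<and> (\<forall>\<^sub>F m in sequentially. g (T * m + i) dvd
        gcd (f (T * m + i)) (g (T * m + i)) - u m * f (T * m + i))" by blast
  qed
  then obtain u where u: "quasi_poly u"
    and dvd: "\<forall>\<^sub>F n in sequentially. g n dvd gcd (f n) (g n) - u n * f n" by blast
  show ?thesis
  proof (rule that[OF u])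
    show "quasi_poly (\<lambda>n. (gcd (f n) (g n) - u n * f n) div g n)"
      by (intro quasi_poly_div quasi_poly_diff quasi_poly_mult quasi_poly_gcd assms u)
    show "\<forall>\<^sub>F n in sequentially.
        u n * f n + (gcd (f n) (g n) - u n * f n) div g n * g n = gcd (f n) (g n)"
      using dvd by eventually_elim simp
  qed
qed

subsection \<open>Floor sums\<close>

lemma le_div_iff_mult_le_int:
  fixes a b c :: int
  assumes "c > 0"
  shows "a \<le> b div c \<longleftrightarrow> c * a \<le> b"
proof
  assume "a \<le> b div c"
  then have "c * a \<le> c * (b div c)" using assms by simp
  also have "\<dots> \<le> b" using pos_mod_sign[OF assms, of b] mult_div_mod_eq[of c b] by linarith
  finally show "c * a \<le> b" .
next
  assume "c * a \<le> b"
  then have "c * a div c \<le> b div c" using assms by (intro zdiv_mono1)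
  then show "a \<le> b div c" using assms by simp
qed

text \<open>The inner bound is the ceiling of \<open>(K - j) / d\<close>, so \<open>i\<close> runs
  over exactly those values with \<open>d * i + j < K\<close>.\<close>

lemma sum_int_split_mod:
  fixes g :: "int \<Rightarrow> int" and d K :: int
  assumes "d > 0"
  shows "(\<Sum>k\<in>{0..<K}. g k) = (\<Sum>j\<in>{0..<d}. \<Sum>i\<in>{0..<(K - j + d - 1) div d}. g (d * i + j))"
proof -
  have bound: "i < (K - j + d - 1) div d \<longleftrightarrow> d * i + j < K" for i j
  proof -
    have "i < (K - j + d - 1) div d \<longleftrightarrow> i + 1 \<le> (K - j + d - 1) div d" by linarith
    also have "\<dots> \<longleftrightarrow> d * (i + 1) \<le> K - j + d - 1"
      by (rule le_div_iff_mult_le_int[OF assms])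
    also have "\<dots> \<longleftrightarrow> d * i + j < K" by (auto simp: algebra_simps)
    finally show ?thesis .
  qed
  have "(\<Sum>k\<in>{0..<K}. g k) = (\<Sum>j\<in>{0..<d}. \<Sum>k\<in>{k\<in>{0..<K}. k mod d = j}. g k)"
    using assms by (intro sum.group[symmetric]) auto
  also have "\<dots> = (\<Sum>j\<in>{0..<d}. \<Sum>i\<in>{0..<(K - j + d - 1) div d}. g (d * i + j))"
  proof (rule sum.cong[OF refl])
    fix j assume j: "j \<in> {0..<d}"
    show "(\<Sum>k\<in>{k\<in>{0..<K}. k mod d = j}. g k) =
        (\<Sum>i\<in>{0..<(K - j + d - 1) div d}. g (d * i + j))"
      by (rule sum.reindex_bij_witness[where i = "\<lambda>i. d * i + j" and j = "\<lambda>k. k div d"])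
        (use assms j bound in \<open>auto simp: pos_imp_zdiv_nonneg_iff\<close>)
  qed
  finally show ?thesis .
qed

section \<open>Reciprocity: exchanging slope and modulus\<close>

text \<open>Double counting of the pairs \<open>(k, y)\<close> in the box \<open>K\<close> by
  \<open>M\<close> with \<open>q * (y + 1) \<le> A + r * k\<close>: for fixed \<open>k\<close> they
  number the floor on the left, for fixed \<open>y\<close> the shifted floor with denominator
  \<open>r\<close>.\<close>

lemma floor_sum_reciprocity_aux:
  fixes A q r K :: int
  assumes "q > 0" "r > 0" "0 \<le> A" "A < q" "K \<ge> 0"
  defines "M \<equiv> (A + r * K) div q"
  shows "(\<Sum>k\<in>{0..<K}. (A + r * k) div q) = M * K + (\<Sum>y\<in>{0..<M}. (A - q + (- q) * y) div r)"
proof -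
  have M: "M \<ge> 0" using assms by (simp add: M_def pos_imp_zdiv_nonneg_iff)
  have row: "(\<Sum>y\<in>{0..<M}. of_bool (q * (y + 1) \<le> A + r * k)) = (A + r * k) div q"
    if k: "k \<in> {0..<K}" for k
  proof -
    define N where "N = (A + r * k) div q"
    have "N \<le> M"
      unfolding M_def N_def using assms k by (intro zdiv_mono1) auto
    have iff: "q * (y + 1) \<le> A + r * k \<longleftrightarrow> y < N" for y
      using le_div_iff_mult_le_int[OF \<open>q > 0\<close>, of "y + 1" "A + r * k"] unfolding N_def by linarith
    have "{0..<M} \<inter> {y. y < N} = {0..<N}" using \<open>N \<le> M\<close> by auto
    moreover have "N \<ge> 0" unfolding N_def using assms k by (simp add: pos_imp_zdiv_nonneg_iff)
    ultimately show ?thesis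
      unfolding iff N_def[symmetric] by (simp add: of_bool_def sum.If_cases)
  qed
  have col: "(\<Sum>k\<in>{0..<K}. of_bool (q * (y + 1) \<le> A + r * k)) = K + (A - q + (- q) * y) div r"
    if y: "y \<in> {0..<M}" for y
  proof -
    define c where "c = (A - q + (- q) * y) div r"
    have iff: "q * (y + 1) \<le> A + r * k \<longleftrightarrow> - c \<le> k" for k
    proof -
      have "q * (y + 1) \<le> A + r * k \<longleftrightarrow> r * (- k) \<le> A - q + (- q) * y"
        by (auto simp: algebra_simps)
      also have "\<dots> \<longleftrightarrow> - k \<le> c"
        unfolding c_def by (rule le_div_iff_mult_le_int[OF \<open>r > 0\<close>, symmetric])
      finally show ?thesis by linarith
    qed
    \<comment> \<open>The bound \<open>A < q\<close> excludes \<open>k = 0\<close>, so the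
      admissible \<open>k\<close> start at \<open>- c > 0\<close>; below, \<open>y < M\<close> gives
      \<open>- c \<le> K\<close>. Hence their number is exactly \<open>K + c\<close>.\<close>
    have "q * (y + 1) \<ge> q" using y \<open>q > 0\<close> by (simp add: algebra_simps)
    then have "\<not> q * (y + 1) \<le> A + r * 0" using \<open>A < q\<close> by simp
    then have "0 < - c" using iff[of 0] by linarith
    have "q * (y + 1) \<le> A + r * K"
      using le_div_iff_mult_le_int[OF \<open>q > 0\<close>, of "y + 1" "A + r * K"] y by (auto simp: M_def)
    then have "- c \<le> K" using iff by blast
    have "{0..<K} \<inter> {k. - c \<le> k} = {- c..<K}"
      using \<open>0 < - c\<close> by auto
    then show ?thesis
      unfolding iff c_def[symmetric] using \<open>- c \<le> K\<close> by (simp add: of_bool_def sum.If_cases)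
  qed
  have "(\<Sum>k\<in>{0..<K}. (A + r * k) div q) =
      (\<Sum>k\<in>{0..<K}. \<Sum>y\<in>{0..<M}. of_bool (q * (y + 1) \<le> A + r * k))"
    by (intro sum.cong refl row[symmetric])
  also have "\<dots> = (\<Sum>y\<in>{0..<M}. \<Sum>k\<in>{0..<K}. of_bool (q * (y + 1) \<le> A + r * k))"
    by (rule sum.swap)
  also have "\<dots> = (\<Sum>y\<in>{0..<M}. K + (A - q + (- q) * y) div r)"
    by (intro sum.cong refl col)
  also have "\<dots> = M * K + (\<Sum>y\<in>{0..<M}. (A - q + (- q) * y) div r)"
    using M by (simp add: sum.distrib)
  finally show ?thesis .
qed

lemma floor_sum_reciprocity:
  fixes A q r K :: int
  assumes "q > 0" "r > 0" "K \<ge> 0"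
  defines "M \<equiv> (A mod q + r * K) div q"
  shows "(\<Sum>k\<in>{0..<K}. (A + r * k) div q) =
    A div q * K + M * K + (\<Sum>y\<in>{0..<M}. (A mod q - q + (- q) * y) div r)"
proof -
  have "(A + r * k) div q = A div q + (A mod q + r * k) div q" for k
  proof -
    have "A + r * k = (A mod q + r * k) + q * (A div q)" by simp
    then have "(A + r * k) div q = ((A mod q + r * k) + q * (A div q)) div q" by simp
    then show ?thesis using \<open>q > 0\<close> by (simp only: div_mult_self2)
  qed
  then have "(\<Sum>k\<in>{0..<K}. (A + r * k) div q) =
      A div q * K + (\<Sum>k\<in>{0..<K}. (A mod q + r * k) div q)"
    using \<open>K \<ge> 0\<close> by (simp add: sum.distrib)
  also have "(\<Sum>k\<in>{0..<K}. (A mod q + r * k) div q) =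
      M * K + (\<Sum>y\<in>{0..<M}. (A mod q - q + (- q) * y) div r)"
    unfolding M_def using assms by (intro floor_sum_reciprocity_aux) auto
  finally show ?thesis by simp
qed

text \<open>The reflection of \<open>k\<close> to \<open>K - 1 - k\<close> turns a negative slope
  into a positive one, as reciprocity requires.\<close>

lemma floor_sum_reverse:
  fixes A B C K :: int
  shows "(\<Sum>k\<in>{0..<K}. (A + B * k) div C) = (\<Sum>k\<in>{0..<K}. (A + B * (K - 1) + (- B) * k) div C)"
  by (rule sum.reindex_bij_witness[where i = "\<lambda>k. K - 1 - k" and j = "\<lambda>k. K - 1 - k"])
    (auto simp: algebra_simps)

lemma sum_int_upto:
  fixes K :: int
  assumes "K \<ge> 0"
  shows "(\<Sum>k\<in>{0..<K}. k) = K * (K - 1) div 2"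
proof -
  have "2 * (\<Sum>k\<in>{0..<int n}. k) = int n * (int n - 1)" for n
  proof (induction n)
    case (Suc n)
    have "{0..<int (Suc n)} = insert (int n) {0..<int n}" by auto
    with Suc show ?case by (simp add: algebra_simps)
  qed simp
  from this[of "nat K"] assms show ?thesis by simp
qed

text \<open>A Euclidean algorithm on the pair (slope, modulus). Splitting the range modulo \<open>d\<close>, where
  \<open>d * p = h * q + r\<close>, replaces the slope \<open>p\<close> by \<open>r\<close>, and reciprocity then exchanges the slope
  and the modulus. Splitting the range is what makes the degree drop: the reduced slope
  \<open>p mod q\<close> may have the same degree as \<open>q\<close>.\<close>

lemma quasi_poly_floor_sum_poly:
  fixes p q :: "int poly"
  assumes "\<forall>\<^sub>F n in sequentially. poly q (int n) > 0" and "quasi_poly A" and "quasi_poly K"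
  shows "quasi_poly (\<lambda>n. \<Sum>k\<in>{0..<K n}. (A n + poly p (int n) * k) div poly q (int n))"
  using assms
proof (induction "degree q" arbitrary: p q A K rule: less_induct)
  case less
  note q_pos = less.prems(1)
  \<comment> \<open>Reciprocity moves \<open>r\<close>, of smaller degree than \<open>q\<close>,
    into the denominator, and the induction hypothesis applies with slope \<open>- q\<close>. For
    \<open>K n < 0\<close> the sum is empty, whence the case distinction.\<close>
  have reduced_pos: "quasi_poly (\<lambda>n. \<Sum>k\<in>{0..<K n}. (A n + poly r (int n) * k) div poly q (int n))"
    if r: "degree r < degree q" "\<forall>\<^sub>F n in sequentially. poly r (int n) > 0"
      and qp: "quasi_poly A" "quasi_poly K" for r A K
  proof -
    define M where "M n = (A n mod poly q (int n) + poly r (int n) * K n) div poly q (int n)" for n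
    have M: "quasi_poly M" unfolding M_def
      by (intro quasi_poly_div quasi_poly_add quasi_poly_mod quasi_poly_mult quasi_poly_poly qp)
    have "quasi_poly (\<lambda>n. if K n \<ge> 0 then A n div poly q (int n) * K n + M n * K n +
        (\<Sum>y\<in>{0..<M n}. (A n mod poly q (int n) - poly q (int n) + poly (- q) (int n) * y)
          div poly r (int n)) else 0)"
      by (intro quasi_poly_if_nonneg quasi_poly_add quasi_poly_mult quasi_poly_div quasi_poly_poly
          less.hyps quasi_poly_diff quasi_poly_mod quasi_poly_const qp r M)
    moreover have "\<forall>\<^sub>F n in sequentially. (if K n \<ge> 0 then A n div poly q (int n) * K n + M n * K n +
        (\<Sum>y\<in>{0..<M n}. (A n mod poly q (int n) - poly q (int n) + poly (- q) (int n) * y)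
          div poly r (int n)) else 0) =
        (\<Sum>k\<in>{0..<K n}. (A n + poly r (int n) * k) div poly q (int n))"
      using q_pos r(2)
    proof eventually_elim
      case (elim n)
      then show ?case
        using floor_sum_reciprocity[of "poly q (int n)" "poly r (int n)" "K n" "A n"]
        by (simp add: M_def)
    qed
    ultimately show ?thesis by (rule quasi_poly_cong[rotated])
  qed
  have reduced: "quasi_poly (\<lambda>n. \<Sum>k\<in>{0..<K n}. (A n + poly r (int n) * k) div poly q (int n))"
    if r: "r = 0 \<or> degree r < degree q" and qp: "quasi_poly A" "quasi_poly K" for r A K
  proof (cases r rule: poly_sign_cases)
    case 1
    have "quasi_poly (\<lambda>n. if K n \<ge> 0 then K n * (A n div poly q (int n)) else 0)"
      by (intro quasi_poly_if_nonneg quasi_poly_mult quasi_poly_div quasi_poly_poly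
          quasi_poly_const qp)
    then show ?thesis
      by (rule quasi_poly_cong[rotated]) (simp add: 1)
  next
    case 2
    then have "r \<noteq> 0" by auto
    with r 2 qp show ?thesis by (intro reduced_pos) auto
  next
    case 3
    then have "r \<noteq> 0" by auto
    have "quasi_poly (\<lambda>n. \<Sum>k\<in>{0..<K n}.
        (A n + poly r (int n) * (K n - 1) + poly (- r) (int n) * k) div poly q (int n))"
      using r 3 \<open>r \<noteq> 0\<close> by (intro reduced_pos quasi_poly_add quasi_poly_mult quasi_poly_diff
          quasi_poly_poly quasi_poly_const qp) auto
    then show ?thesis
      by (subst floor_sum_reverse) simp
  qed
  have "q \<noteq> 0" using q_pos by auto
  then obtain d h r where d: "d > 0" and eq: "smult (int d) p = h * q + r"
    and r: "r = 0 \<or> degree r < degree q"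
    by (rule int_poly_pseudo_division)
  have eq: "int d * poly p x = poly h x * poly q x + poly r x" for x
    using arg_cong[OF eq, of "\<lambda>p. poly p x"] by simp
  \<comment> \<open>The number of \<open>i\<close> with \<open>int d * i + j < K n\<close>, or a
    nonpositive value if there are none; hence the sign test on \<open>L j n\<close> before the
    closed form for the sum of the indices.\<close>
  define L where "L j n = (K n - j + int d - 1) div int d" for j n
  have L: "quasi_poly (L j)" for j
    unfolding L_def
    by (intro quasi_poly_div quasi_poly_add quasi_poly_diff quasi_poly_const less.prems)
  have "quasi_poly (\<lambda>n. \<Sum>j\<in>{0..<int d}.
      (if L j n \<ge> 0 then poly h (int n) * (L j n * (L j n - 1) div 2) else 0) +
      (\<Sum>i\<in>{0..<L j n}. (A n + poly p (int n) * j + poly r (int n) * i) div poly q (int n)))"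
    by (intro quasi_poly_sum quasi_poly_add reduced r quasi_poly_if_nonneg quasi_poly_mult L
        quasi_poly_div quasi_poly_diff quasi_poly_poly quasi_poly_const less.prems)
  moreover have "\<forall>\<^sub>F n in sequentially. (\<Sum>j\<in>{0..<int d}.
      (if L j n \<ge> 0 then poly h (int n) * (L j n * (L j n - 1) div 2) else 0) +
      (\<Sum>i\<in>{0..<L j n}. (A n + poly p (int n) * j + poly r (int n) * i) div poly q (int n)))
      = (\<Sum>k\<in>{0..<K n}. (A n + poly p (int n) * k) div poly q (int n))"
    using q_pos
  proof eventually_elim
    case (elim n)
    \<comment> \<open>Along a class modulo \<open>d\<close> the slope is
      \<open>int d * p = h * q + r\<close>; the multiple of \<open>q\<close> leaves the floor as the
      linear term \<open>h * i\<close>.\<close>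
    have split: "(A n + poly p (int n) * (int d * i + j)) div poly q (int n) =
        poly h (int n) * i + (A n + poly p (int n) * j + poly r (int n) * i) div poly q (int n)"
      for i j
    proof -
      have "poly p (int n) * (int d * i) = (poly h (int n) * poly q (int n) + poly r (int n)) * i"
        unfolding eq[symmetric] by simp
      then have "A n + poly p (int n) * (int d * i + j) =
          (A n + poly p (int n) * j + poly r (int n) * i) + poly q (int n) * (poly h (int n) * i)"
        by (simp add: algebra_simps)
      then show ?thesis using elim by (simp only: div_mult_self2)
    qed
    have linear: "(\<Sum>i\<in>{0..<L j n}. poly h (int n) * i) =
        (if L j n \<ge> 0 then poly h (int n) * (L j n * (L j n - 1) div 2) else 0)" for j
      by (simp add: sum_distrib_left[symmetric] sum_int_upto)
    have "int d > 0" using d by simp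
    then show ?case
      by (simp only: sum_int_split_mod[of "int d" _ "K n"] L_def[symmetric] split sum.distrib linear)
  qed
  ultimately show ?case by (rule quasi_poly_cong[rotated])
qed

lemma quasi_poly_floor_sum:
  assumes "quasi_poly A" and "quasi_poly B" and "quasi_poly C" and "quasi_poly K"
    and pos: "\<forall>\<^sub>F n in sequentially. C n > 0"
  shows "quasi_poly (\<lambda>n. \<Sum>k\<in>{0..<K n}. (A n + B n * k) div C n)"
proof (rule quasi_poly_localI[OF assms(2,3)])
  fix T i p q
  assume T: "T > 0" and ev: "\<forall>\<^sub>F m in sequentially. B (T * m + i) = poly p (int m)"
    "\<forall>\<^sub>F m in sequentially. C (T * m + i) = poly q (int m)"
  have "\<forall>\<^sub>F m in sequentially. poly q (int m) > 0"
    using eventually_progression[OF pos T, of i] ev(2) by eventually_elim simp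
  then have "quasi_poly (\<lambda>m. \<Sum>k\<in>{0..<K (T * m + i)}.
      (A (T * m + i) + poly p (int m) * k) div poly q (int m))"
    by (intro quasi_poly_floor_sum_poly quasi_poly_progression assms T)
  moreover have "\<forall>\<^sub>F m in sequentially. (\<Sum>k\<in>{0..<K (T * m + i)}.
      (A (T * m + i) + poly p (int m) * k) div poly q (int m)) =
      (\<Sum>k\<in>{0..<K (T * m + i)}. (A (T * m + i) + B (T * m + i) * k) div C (T * m + i))"
    using ev by eventually_elim simp
  ultimately show "quasi_poly (\<lambda>m. \<Sum>k\<in>{0..<K (T * m + i)}.
      (A (T * m + i) + B (T * m + i) * k) div C (T * m + i))"
    by (rule quasi_poly_cong[rotated])
qed

subsection \<open>Counting solutions\<close>

definition solutions2 :: "int \<Rightarrow> int \<Rightarrow> int \<Rightarrow> (int \<times> int) set" where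
  "solutions2 a b s = {(x, y). x \<ge> 0 \<and> y \<ge> 0 \<and> x * a + y * b = s}"

text \<open>The integer solutions are \<open>(u * s + k * b, v * s - k * a)\<close>, and
  nonnegativity confines \<open>k\<close> to the interval from \<open>- \<alpha>\<close> to
  \<open>\<beta>\<close>.\<close>

lemma solutions2_coprime:
  fixes a b s u v :: int
  assumes a: "a > 0" and b: "b > 0" and bez: "u * a + v * b = 1" and s: "s \<ge> 0"
  shows "finite (solutions2 a b s)"
    and "int (card (solutions2 a b s)) = v * s div a + u * s div b + 1"
proof -
  define \<alpha> \<beta> where "\<alpha> = u * s div b" and "\<beta> = v * s div a"
  have sum: "(u * s) * a + (v * s) * b = s"
    using arg_cong[OF bez, of "\<lambda>z. z * s"] by (simp add: algebra_simps)
  have "bij_betw (\<lambda>k. (u * s + k * b, v * s - k * a)) {- \<alpha>..\<beta>} (solutions2 a b s)"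
  proof (rule bij_betwI')
    fix k l
    show "(u * s + k * b, v * s - k * a) = (u * s + l * b, v * s - l * a) \<longleftrightarrow> k = l"
      using a by auto
  next
    fix k assume "k \<in> {- \<alpha>..\<beta>}"
    then have "- k \<le> \<alpha>" "k \<le> \<beta>" by auto
    then have "u * s + k * b \<ge> 0" "v * s - k * a \<ge> 0"
      unfolding \<alpha>_def \<beta>_def by (simp_all add: le_div_iff_mult_le_int a b mult.commute)
    moreover have "(u * s + k * b) * a + (v * s - k * a) * b = s"
      using sum by (simp add: algebra_simps)
    ultimately show "(u * s + k * b, v * s - k * a) \<in> solutions2 a b s"
      unfolding solutions2_def by simp
  next
    fix z assume "z \<in> solutions2 a b s"
    then obtain x y where z: "z = (x, y)" and xy: "x \<ge> 0" "y \<ge> 0" "x * a + y * b = s"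
      unfolding solutions2_def by auto
    \<comment> \<open>The parameter of a given solution, obtained by solving the parametrization
      with the Bezout identity.\<close>
    define k where "k = v * x - u * y"
    have "u * s + k * b = x * (u * a + v * b)" "v * s - k * a = y * (u * a + v * b)"
      unfolding k_def xy(3)[symmetric] by (simp_all add: algebra_simps)
    then have x: "x = u * s + k * b" and y: "y = v * s - k * a" by (simp_all add: bez)
    have "- k \<le> \<alpha>" "k \<le> \<beta>"
      using xy unfolding \<alpha>_def \<beta>_def x y by (simp_all add: le_div_iff_mult_le_int a b mult.commute)
    then show "\<exists>k\<in>{- \<alpha>..\<beta>}. z = (u * s + k * b, v * s - k * a)"
      unfolding z using x y by (intro bexI[of _ k]) auto
  qed
  then have "finite (solutions2 a b s)" and card: "card (solutions2 a b s) = card {- \<alpha>..\<beta>}"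
    using bij_betw_finite bij_betw_same_card by (blast, metis)
  then show "finite (solutions2 a b s)" by blast
  \<comment> \<open>An empty interval has cardinality 0, so the formula also needs
    \<open>\<alpha> + \<beta> + 1 \<ge> 0\<close>; this is where \<open>s \<ge> 0\<close>
    enters.\<close>
  have "\<alpha> + \<beta> + 2 > 0"
  proof -
    have "u * s < b * (\<alpha> + 1)" "v * s < a * (\<beta> + 1)"
      using le_div_iff_mult_le_int[OF b, of "\<alpha> + 1" "u * s"]
        le_div_iff_mult_le_int[OF a, of "\<beta> + 1" "v * s"] unfolding \<alpha>_def \<beta>_def by auto
    then have "(u * s) * a < (b * (\<alpha> + 1)) * a" "(v * s) * b < (a * (\<beta> + 1)) * b"
      using a b by simp_all
    then have "(a * b) * 0 < (a * b) * (\<alpha> + \<beta> + 2)"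
      using sum s by (simp add: algebra_simps)
    then show ?thesis using a b by (simp only: mult_less_cancel_left_pos mult_pos_pos)
  qed
  then show "int (card (solutions2 a b s)) = v * s div a + u * s div b + 1"
    unfolding card \<alpha>_def[symmetric] \<beta>_def[symmetric] by simp
qed

text \<open>If \<open>d\<close> divides \<open>s\<close>, cancelling it leaves a coprime equation
  with the same Bezout coefficients; otherwise there are no solutions.\<close>

lemma solutions2_gcd:
  fixes a b u v :: int
  assumes a: "a > 0" and b: "b > 0" and bez: "u * a + v * b = gcd a b" and s: "s \<ge> 0"
  defines "d \<equiv> gcd a b"
  shows "finite (solutions2 a b s)"
    and "int (card (solutions2 a b s)) =
      (if d dvd s then v * (s div d) div (a div d) + u * (s div d) div (b div d) + 1 else 0)"
proof -
  have d: "d > 0" using a unfolding d_def by simp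
  have "d dvd a" "d dvd b" unfolding d_def by simp_all
  then obtain a' b' where a': "a = d * a'" and b': "b = d * b'" by (metis dvd_def)
  have pos: "a' > 0" "b' > 0" using a b d by (simp_all add: a' b' zero_less_mult_iff)
  have "d * (u * a' + v * b') = d * 1"
  proof -
    have "d * (u * a' + v * b') = u * a + v * b" by (simp add: a' b' algebra_simps)
    then show ?thesis using bez unfolding d_def by simp
  qed
  then have bez': "u * a' + v * b' = 1" using d by simp
  show "finite (solutions2 a b s)" and "int (card (solutions2 a b s)) =
      (if d dvd s then v * (s div d) div (a div d) + u * (s div d) div (b div d) + 1 else 0)"
  proof (atomize (full), cases "d dvd s")
    case True
    then obtain s' where s': "s = d * s'" by blast
    have "x * a + y * b = s \<longleftrightarrow> x * a' + y * b' = s'" for x y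
    proof -
      have "x * a + y * b = d * (x * a' + y * b')" by (simp add: a' b' algebra_simps)
      then show ?thesis using d by (simp add: s')
    qed
    then have "solutions2 a b s = solutions2 a' b' s'" by (simp add: solutions2_def)
    moreover have "s' \<ge> 0" using s d by (simp add: s' zero_le_mult_iff)
    ultimately show "finite (solutions2 a b s) \<and> int (card (solutions2 a b s)) =
      (if d dvd s then v * (s div d) div (a div d) + u * (s div d) div (b div d) + 1 else 0)"
      using solutions2_coprime[OF pos bez'] d by (simp add: a' b' s')
  next
    case False
    have "d dvd x * a + y * b" for x y by (simp add: a' b')
    then have "solutions2 a b s = {}" using False by (auto simp: solutions2_def)
    with False show "finite (solutions2 a b s) \<and> int (card (solutions2 a b s)) =
      (if d dvd s then v * (s div d) div (a div d) + u * (s div d) div (b div d) + 1 else 0)"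
      by simp
  qed
qed

section \<open>From two variables to three\<close>

text \<open>The solution set is sliced by its third coordinate; the slices must be finite for their
  cardinalities to add up.\<close>

lemma denumerant3_eq_sum:
  assumes b: "b1 > 0" "b2 > 0" "b3 > 0" and t: "t \<ge> 0"
  shows "int (denumerant3 b1 b2 b3 t) =
    (\<Sum>z\<in>{0..t div b3}. int (card (solutions2 b1 b2 (t - z * b3))))"
proof -
  define T where "T = Sigma {0..t div b3} (\<lambda>z. solutions2 b1 b2 (t - z * b3))"
  have le: "z * b3 \<le> t" if "z \<in> {0..t div b3}" for z
    using that le_div_iff_mult_le_int[OF b(3), of z t] by (simp add: mult.commute)
  have fin: "finite (solutions2 b1 b2 (t - z * b3))" if "z \<in> {0..t div b3}" for z
    using le[OF that] b bezout_coefficients_fst_snd[of b1 b2]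
    by (intro solutions2_gcd(1)[of b1 b2 "fst (bezout_coefficients b1 b2)"
          "snd (bezout_coefficients b1 b2)"]) auto
  have "{(x1, x2, x3). x1 \<ge> 0 \<and> x2 \<ge> 0 \<and> x3 \<ge> 0 \<and> x1 * b1 + x2 * b2 + x3 * b3 = t}
      = (\<lambda>(z, x, y). (x, y, z)) ` T"
  proof (intro set_eqI iffI)
    fix w assume "w \<in> {(x1, x2, x3). x1 \<ge> 0 \<and> x2 \<ge> 0 \<and> x3 \<ge> 0 \<and> x1 * b1 + x2 * b2 + x3 * b3 = t}"
    then obtain x y z where w: "w = (x, y, z)"
      and xyz: "x \<ge> 0" "y \<ge> 0" "z \<ge> 0" "x * b1 + y * b2 + z * b3 = t" by auto
    have "x * b1 \<ge> 0" "y * b2 \<ge> 0" using xyz b by simp_all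
    then have "b3 * z \<le> t" using xyz(4) by (simp add: mult.commute)
    then have "(z, x, y) \<in> T"
      using xyz le_div_iff_mult_le_int[OF b(3), of z t] by (auto simp: T_def solutions2_def)
    then show "w \<in> (\<lambda>(z, x, y). (x, y, z)) ` T" unfolding w by force
  qed (auto simp: T_def solutions2_def)
  moreover have "inj_on (\<lambda>(z, x, y). (x, y, z)) T" by (auto simp: inj_on_def)
  ultimately have "denumerant3 b1 b2 b3 t = card T"
    unfolding denumerant3_def by (simp add: card_image)
  also have "\<dots> = (\<Sum>z\<in>{0..t div b3}. card (solutions2 b1 b2 (t - z * b3)))"
    unfolding T_def using fin by (intro card_SigmaI) auto
  finally show ?thesis by simp
qed

text \<open>The \<open>z\<close> with \<open>gcd b1 b2 dvd t - z * b3\<close> form the residue class of \<open>x\<close> modulo \<open>\<delta>\<close>, so they are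
  \<open>z = x + \<delta> * k\<close>, and then \<open>(t - z * b3) div gcd b1 b2 = s - c * k\<close>.\<close>

lemma denumerant3_eq_floor_sums:
  fixes b1 b2 b3 t u v w w' :: int
  assumes b: "b1 > 0" "b2 > 0" "b3 > 0" and t: "t \<ge> 0"
    and bez: "u * b1 + v * b2 = gcd b1 b2" and bez3: "w * b3 + w' * gcd b1 b2 = gcd b3 (gcd b1 b2)"
  defines "d \<equiv> gcd b1 b2"
  defines "e \<equiv> gcd b3 d"
  defines "\<delta> \<equiv> d div e" and "c \<equiv> b3 div e"
  defines "x \<equiv> (w * (t div e)) mod \<delta>"
  defines "K \<equiv> (t div b3 - x) div \<delta> + 1" and "s \<equiv> (t - b3 * x) div d"
  shows "int (denumerant3 b1 b2 b3 t) = (if t mod e = 0 then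
    (\<Sum>k\<in>{0..<K}. (v * s + (- (v * c)) * k) div (b1 div d)) +
    (\<Sum>k\<in>{0..<K}. (u * s + (- (u * c)) * k) div (b2 div d)) + K else 0)"
proof -
  have d: "d > 0" using b unfolding d_def by simp
  have e: "e > 0" using d unfolding e_def by simp
  have de: "d = e * \<delta>" and b3e: "b3 = e * c" unfolding \<delta>_def c_def e_def by simp_all
  have \<delta>: "\<delta> > 0" using d e by (simp add: de zero_less_mult_iff)
  \<comment> \<open>Cancelling \<open>e\<close> shows that \<open>w\<close> is an inverse of
    \<open>c\<close> modulo \<open>\<delta>\<close>.\<close>
  have "e * (w * c + w' * \<delta>) = e * 1"
    using bez3 unfolding d_def[symmetric] e_def[symmetric] using de b3e
    by (metis distrib_left mult.left_commute mult.right_neutral)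
  then have bez': "w * c + w' * \<delta> = 1" using e by simp
  define N where "N z = v * ((t - z * b3) div d) div (b1 div d) +
    u * ((t - z * b3) div d) div (b2 div d) + 1" for z
  have "int (denumerant3 b1 b2 b3 t) = (\<Sum>z\<in>{0..t div b3}. if d dvd t - z * b3 then N z else 0)"
    unfolding denumerant3_eq_sum[OF b t]
  proof (rule sum.cong[OF refl])
    fix z assume "z \<in> {0..t div b3}"
    then have "t - z * b3 \<ge> 0"
      using le_div_iff_mult_le_int[OF b(3), of z t] by (simp add: mult.commute)
    from solutions2_gcd(2)[OF b(1,2) bez this]
    show "int (card (solutions2 b1 b2 (t - z * b3))) = (if d dvd t - z * b3 then N z else 0)"
      unfolding N_def d_def .
  qed
  also have "\<dots> = (\<Sum>z\<in>{z\<in>{0..t div b3}. d dvd t - z * b3}. N z)"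
    by (rule sum.inter_filter[symmetric]) simp
  finally have eq: "int (denumerant3 b1 b2 b3 t) = (\<Sum>z\<in>{z\<in>{0..t div b3}. d dvd t - z * b3}. N z)" .
  show ?thesis
  proof (cases "t mod e = 0")
    case False
    have "\<not> d dvd t - z * b3" for z
    proof
      assume "d dvd t - z * b3"
      then have "e dvd t - z * b3" unfolding de by (rule dvd_mult_left)
      then have "e dvd t" by (simp add: b3e dvd_diff_left_iff)
      with False show False by (simp add: dvd_eq_mod_eq_0)
    qed
    then show ?thesis unfolding eq using False by simp
  next
    case True
    then obtain t' where t': "t = e * t'" by (metis dvd_def mod_0_imp_dvd)
    have x: "0 \<le> x" "x < \<delta>" and x_mod: "x = (w * t') mod \<delta>"
      using \<delta> e by (simp_all add: x_def t')
    have dvd_iff: "d dvd t - z * b3 \<longleftrightarrow> z mod \<delta> = x" for z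
    proof -
      have "t - z * b3 = e * (t' - z * c)" by (simp add: t' b3e algebra_simps)
      then have "d dvd t - z * b3 \<longleftrightarrow> \<delta> dvd t' - z * c" using e by (simp add: de)
      \<comment> \<open>The congruence is solved for \<open>z\<close> by multiplying with
        \<open>w\<close> in one direction and with \<open>c\<close> in the other.\<close>
      also have "\<dots> \<longleftrightarrow> \<delta> dvd z - w * t'"
      proof
        assume "\<delta> dvd t' - z * c"
        then have "\<delta> dvd z * w' * \<delta> - w * (t' - z * c)" by simp
        also have "z * w' * \<delta> - w * (t' - z * c) = z * (w * c + w' * \<delta>) - w * t'"
          by (simp add: algebra_simps)
        finally show "\<delta> dvd z - w * t'" by (simp add: bez')
      next
        assume "\<delta> dvd z - w * t'"
        then have "\<delta> dvd t' * w' * \<delta> - c * (z - w * t')" by simp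
        also have "t' * w' * \<delta> - c * (z - w * t') = t' * (w * c + w' * \<delta>) - z * c"
          by (simp add: algebra_simps)
        finally show "\<delta> dvd t' - z * c" by (simp add: bez')
      qed
      also have "\<dots> \<longleftrightarrow> z mod \<delta> = x" by (simp add: x_mod mod_eq_dvd_iff)
      finally show ?thesis .
    qed
    have "d dvd t - x * b3" using dvd_iff x by simp
    then have ds: "t - x * b3 = d * s" by (simp add: s_def mult.commute)
    have quot: "(t - (x + \<delta> * k) * b3) div d = s - c * k" for k
    proof -
      have "t - (x + \<delta> * k) * b3 = d * (s - c * k)"
        using ds by (simp add: de b3e algebra_simps)
      then show ?thesis using d by simp
    qed
    have bound: "k < K \<longleftrightarrow> x + \<delta> * k \<le> t div b3" for k
      using le_div_iff_mult_le_int[OF \<delta>, of k "t div b3 - x"] unfolding K_def by linarith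
    \<comment> \<open>The constant 1 in each term must sum to \<open>K\<close> even when no
      \<open>z\<close> is admissible; \<open>x < \<delta>\<close> prevents \<open>K\<close> from
      becoming negative.\<close>
    have K: "K \<ge> 0"
    proof -
      have "t div b3 \<ge> 0" using t b by (simp add: pos_imp_zdiv_nonneg_iff)
      then have "\<delta> * (- 1) \<le> t div b3 - x" using x by simp
      then show ?thesis using le_div_iff_mult_le_int[OF \<delta>, of "- 1" "t div b3 - x"]
        unfolding K_def by linarith
    qed
    have "(\<Sum>z\<in>{z\<in>{0..t div b3}. d dvd t - z * b3}. N z) = (\<Sum>k\<in>{0..<K}. N (x + \<delta> * k))"
      unfolding dvd_iff
    proof (rule sum.reindex_bij_witness[where i = "\<lambda>k. x + \<delta> * k" and j = "\<lambda>z. z div \<delta>"])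
      fix z assume z: "z \<in> {z \<in> {0..t div b3}. z mod \<delta> = x}"
      then show zx: "x + \<delta> * (z div \<delta>) = z" using mod_mult_div_eq[of z \<delta>] by simp
      then show "N (x + \<delta> * (z div \<delta>)) = N z" by simp
      show "z div \<delta> \<in> {0..<K}"
        using z \<delta> bound[of "z div \<delta>"] zx by (simp add: pos_imp_zdiv_nonneg_iff)
    next
      fix k assume k: "k \<in> {0..<K}"
      show "(x + \<delta> * k) div \<delta> = k" using x by simp
      show "x + \<delta> * k \<in> {z \<in> {0..t div b3}. z mod \<delta> = x}"
        using k x \<delta> bound[of k] by simp
    qed
    also have "\<dots> = (\<Sum>k\<in>{0..<K}. (v * s + (- (v * c)) * k) div (b1 div d)) +
        (\<Sum>k\<in>{0..<K}. (u * s + (- (u * c)) * k) div (b2 div d)) + K"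
      unfolding N_def quot using K by (simp add: sum.distrib algebra_simps)
    finally show ?thesis unfolding eq using True by simp
  qed
qed

section \<open>The denumerant along quasi-polynomials\<close>

lemma pos_quasi_polyD:
  assumes "pos_quasi_poly f"
  shows "quasi_poly f" and "\<forall>\<^sub>F n in sequentially. f n > 0"
proof -
  from assms obtain T C F where rep: "quasi_poly_rep f T C F"
    and F: "\<And>i. i < T \<Longrightarrow> lead_coeff (F i) > 0"
    unfolding pos_quasi_poly_def by blast
  then show "quasi_poly f" unfolding quasi_poly_def by blast
  from rep have T: "T > 0"
    and f: "\<And>m i. T * m + i > C \<Longrightarrow> i < T \<Longrightarrow> f (T * m + i) = poly (F i) (int m)"
    unfolding quasi_poly_rep_def by auto
  have "\<forall>\<^sub>F m in sequentially. \<forall>i\<in>{..<T}. poly (F i) (int m) > 0"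
    using F eventually_poly_pos by (intro eventually_ball_finite) auto
  then obtain N where N: "\<And>m i. m \<ge> N \<Longrightarrow> i < T \<Longrightarrow> poly (F i) (int m) > 0"
    by (auto simp: eventually_sequentially)
  have "f n > 0" if "n > C" "n \<ge> T * N" for n
  proof -
    have "N \<le> n div T" using T that by (simp add: less_eq_div_iff_mult_less_eq mult.commute)
    then show ?thesis using f[of "n div T" "n mod T"] N[of "n div T" "n mod T"] T that by simp
  qed
  then show "\<forall>\<^sub>F n in sequentially. f n > 0"
    unfolding eventually_sequentially by (intro exI[of _ "Suc C + T * N"]) auto
qed

theorem corollary4p4:
  fixes a1 a2 a3 m :: "nat \<Rightarrow> int"
  assumes "pos_quasi_poly a1" and "pos_quasi_poly a2" and "pos_quasi_poly a3"
    and "pos_quasi_poly m"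
  shows "\<exists>g. quasi_poly g \<and>
           (\<forall>\<^sub>F n in sequentially. int (denumerant3 (a1 n) (a2 n) (a3 n) (m n)) = g n)"
proof -
  note qp = assms[THEN pos_quasi_polyD(1)] and pos = assms[THEN pos_quasi_polyD(2)]
  \<comment> \<open>These and the following functions repeat, pointwise in \<open>n\<close>, the
    constants of \<open>denumerant3_eq_floor_sums\<close>, each now shown to be a
    quasi-polynomial.\<close>
  define d e where "d n = gcd (a1 n) (a2 n)" and "e n = gcd (a3 n) (d n)" for n
  have d: "quasi_poly d" unfolding d_def by (intro quasi_poly_gcd qp)
  have e: "quasi_poly e" unfolding e_def by (intro quasi_poly_gcd qp d)
  obtain u v where uv: "quasi_poly u" "quasi_poly v"
    "\<forall>\<^sub>F n in sequentially. u n * a1 n + v n * a2 n = d n"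
    unfolding d_def by (rule quasi_poly_bezout[OF qp(1,2)])
  obtain w w' where w: "quasi_poly w" "\<forall>\<^sub>F n in sequentially. w n * a3 n + w' n * d n = e n"
    unfolding e_def by (rule quasi_poly_bezout[OF qp(3) d])
  define \<delta> c where "\<delta> n = d n div e n" and "c n = a3 n div e n" for n
  define x where "x n = (w n * (m n div e n)) mod \<delta> n" for n
  define K s where "K n = (m n div a3 n - x n) div \<delta> n + 1" and "s n = (m n - a3 n * x n) div d n" for n
  have qp': "quasi_poly \<delta>" "quasi_poly c"
    unfolding \<delta>_def c_def by (intro quasi_poly_div qp d e)+
  have x: "quasi_poly x"
    unfolding x_def by (intro quasi_poly_mod quasi_poly_mult quasi_poly_div qp qp' w e)
  have Ks: "quasi_poly K" "quasi_poly s"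
    unfolding K_def s_def
    by (intro quasi_poly_add quasi_poly_diff quasi_poly_mult quasi_poly_div quasi_poly_const qp qp' x d)+
  \<comment> \<open>Floor sums require eventually positive denominators; here the positive
    \<open>d n\<close> divides the positive \<open>a1 n\<close> and \<open>a2 n\<close>.\<close>
  have pos_div: "\<forall>\<^sub>F n in sequentially. a1 n div d n > 0" "\<forall>\<^sub>F n in sequentially. a2 n div d n > 0"
    using pos(1,2) by (eventually_elim, auto simp: d_def pos_imp_zdiv_pos_iff zdvd_imp_le)+
  define g where "g n = (if m n mod e n = 0 then
    (\<Sum>k\<in>{0..<K n}. (v n * s n + (- (v n * c n)) * k) div (a1 n div d n)) +
    (\<Sum>k\<in>{0..<K n}. (u n * s n + (- (u n * c n)) * k) div (a2 n div d n)) + K n else 0)" for n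
  have "quasi_poly g"
    unfolding g_def
    by (intro quasi_poly_if_zero quasi_poly_mod quasi_poly_add quasi_poly_floor_sum pos_div
        quasi_poly_mult quasi_poly_uminus quasi_poly_div quasi_poly_const qp qp' d e uv(1,2) Ks)
  moreover have "\<forall>\<^sub>F n in sequentially. int (denumerant3 (a1 n) (a2 n) (a3 n) (m n)) = g n"
    using pos uv(3) w(2)
  proof eventually_elim
    case (elim n)
    then show ?case
      unfolding g_def K_def s_def x_def \<delta>_def c_def e_def d_def
      by (intro denumerant3_eq_floor_sums) auto
  qed
  ultimately show ?thesis by blast
qed

end
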